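(* Let $G$ be a finite simple bipartite graph of order $2n$ with a perfect matching, and suppose $f(G)=k$ where $0\leq k\leq n-1$. Then $$e(G)\leq \frac{(n-k)(n+k+1)}{2}+nk,$$ and equality holds if and only if $G$ is isomorphic to $H_{n,k}$.
   Context: For a graph $G$ with a perfect matching $M$, a subset $S\subseteq M$ is a forcing set of $M$ if $S$ is contained in no perfect matching of $G$ other than $M$. $f(G,M)$ is the minimum size of a forcing set of $M$, and $f(G)=\min_M f(G,M)$ over all perfect matchings $M$. $e(G)$ is the number of edges. For integers $0\leq k\leq n-1$, $H_{n,k}$ is the bipartite graph with parts $U=\{u_1,\dots,u_n\}$ and $V=\{v_1,\dots,v_n\}$ in which $u_iv_j$ (for $1\le i,j\le n$) is a non-edge if and only if $1\leq i<j\leq n-k$ (all other pairs $u_iv_j$ are edges). *)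

theory Defs
  imports Complex_Main
begin

type_synonym 'a ugraph = "'a set \<times> 'a set set"

abbreviation vertices :: "'a ugraph \<Rightarrow> 'a set" where
  "vertices G \<equiv> fst G"

abbreviation edges :: "'a ugraph \<Rightarrow> 'a set set" where
  "edges G \<equiv> snd G"

definition finite_simple_graph :: "'a ugraph \<Rightarrow> bool" where
  "finite_simple_graph G \<longleftrightarrow>
     finite (vertices G) \<and> (\<forall>e\<in>edges G. e \<subseteq> vertices G \<and> card e = 2)"

definition bipartite :: "'a ugraph \<Rightarrow> bool" where
  "bipartite G \<longleftrightarrow>
     (\<exists>A B. A \<union> B = vertices G \<and> A \<inter> B = {} \<and>
        (\<forall>e\<in>edges G. \<exists>a\<in>A. \<exists>b\<in>B. e = {a, b}))"

definition perfect_matching :: "'a ugraph \<Rightarrow> 'a set set \<Rightarrow> bool" where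
  "perfect_matching G M \<longleftrightarrow> M \<subseteq> edges G \<and> (\<forall>v\<in>vertices G. \<exists>!e. e \<in> M \<and> v \<in> e)"

definition forcing_set :: "'a ugraph \<Rightarrow> 'a set set \<Rightarrow> 'a set set \<Rightarrow> bool" where
  "forcing_set G M S \<longleftrightarrow>
     S \<subseteq> M \<and> (\<forall>M'. perfect_matching G M' \<and> S \<subseteq> M' \<longrightarrow> M' = M)"

text \<open>
  For a finite simple graph and a perfect matching \<open>M\<close>, the set below is finite and
  contains \<open>card M\<close>, so \<open>Min\<close> is the true minimum.
\<close>

definition forcing_number_of :: "'a ugraph \<Rightarrow> 'a set set \<Rightarrow> nat" where
  "forcing_number_of G M = Min {card S | S. forcing_set G M S}"

text \<open>Meaningful only for finite graphs that have a perfect matching.\<close>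

definition forcing_number :: "'a ugraph \<Rightarrow> nat" where
  "forcing_number G = Min {forcing_number_of G M | M. perfect_matching G M}"

definition graph_isomorphic :: "'a ugraph \<Rightarrow> 'b ugraph \<Rightarrow> bool" where
  "graph_isomorphic G H \<longleftrightarrow>
     (\<exists>\<phi>. bij_betw \<phi> (vertices G) (vertices H) \<and>
        (\<forall>u\<in>vertices G. \<forall>v\<in>vertices G. {u, v} \<in> edges G \<longleftrightarrow> {\<phi> u, \<phi> v} \<in> edges H))"

text \<open>
  The vertices $u_i$ and $v_j$ are \<open>Inl i\<close> and \<open>Inr j\<close>, with indices running from 1 to \<open>n\<close>.
  The definition is meant for \<open>k < n\<close>, where \<open>n - k\<close> does not truncate.
\<close>

definition H_graph :: "nat \<Rightarrow> nat \<Rightarrow> (nat + nat) ugraph" where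
  "H_graph n k =
     (Inl ` {1..n} \<union> Inr ` {1..n},
      {{Inl i, Inr j} | i j. i \<in> {1..n} \<and> j \<in> {1..n} \<and> \<not> (1 \<le> i \<and> i < j \<and> j \<le> n - k)})"

end

(*
  A minimum forcing set S of a suitable perfect matching M has k edges.  Let m = n - k.
  Among the m edges a_i b_i of M - S, no alternating cycle can occur.  Alternating
  4-cycles being excluded, each of the m choose 2 pairs i, j contributes a non-edge
  a_i b_j or a_j b_i, which is the bound.  In the case of equality there are no further
  non-edges, so they form a tournament on the m edges of M - S; it is transitive because
  alternating 6-cycles are excluded too, and ranking the tournament gives the numbering
  of the vertices of H_{n,k}.
*)
theory Submission
  imports Defs "HOL-Combinatorics.Permutations"
begin

section \<open>Tournaments\<close>

text \<open>Both the bound and its equality case come from this identity. For the non-edges inside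
  \<open>T\<close> the union consists of all off-diagonal pairs, so the intersection measures the
  excess over the bound.\<close>

lemma card_Un_converse:
  assumes "finite R"
  shows "card (R \<union> R\<inverse>) + card (R \<inter> R\<inverse>) = 2 * card R"
  using card_Un_Int[of R "R\<inverse>"] assms by (simp add: card_inverse)

lemma card_off_diagonal:
  assumes "finite T"
  shows "card (T \<times> T - Id) = card T * (card T - 1)"
proof -
  have "T \<times> T - Id = T \<times> T - Id_on T" by auto
  moreover have "card (Id_on T) = card T"
    by (rule bij_betw_same_card[of fst]) (force simp: bij_betw_def inj_on_def image_iff)
  moreover have "Id_on T \<subseteq> T \<times> T" "finite (Id_on T)"
    using assms finite_subset[of "Id_on T" "T \<times> T"] by auto
  ultimately show ?thesis
    by (simp add: card_Diff_subset card_cartesian_product diff_mult_distrib2)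
qed

lemma card_tournament:
  assumes "finite T" "R \<union> R\<inverse> = T \<times> T - Id" "R \<inter> R\<inverse> = {}"
  shows "2 * card R = card T * (card T - 1)"
proof -
  have "finite R" using assms(1,2) finite_subset[of R "T \<times> T"] by blast
  then show ?thesis
    using card_Un_converse[of R] card_off_diagonal[of T] assms by simp
qed

text \<open>The rank of an element is one more than the number of its predecessors. Transitivity
  makes the set of predecessors grow along \<open>R\<close>, strictly because \<open>a\<close>
  precedes \<open>b\<close> but not itself. Totality makes the ranks distinct, so they fill
  \<open>{1..card T}\<close>.\<close>

lemma transitive_tournament_rank:
  assumes "finite T" "R \<union> R\<inverse> = T \<times> T - Id" "R \<inter> R\<inverse> = {}" "trans R"
  shows "\<exists>g. bij_betw g T {1..card T} \<and> (\<forall>a\<in>T. \<forall>b\<in>T. (a, b) \<in> R \<longleftrightarrow> g a < g b)"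
proof -
  define g where "g a = Suc (card {x \<in> T. (x, a) \<in> R})" for a
  have irr: "(a, a) \<notin> R" for a using assms(2) by blast
  have less: "g a < g b" if "(a, b) \<in> R" for a b
  proof -
    have "a \<in> T" using that assms(2) by blast
    then have "{x \<in> T. (x, a) \<in> R} \<subset> {x \<in> T. (x, b) \<in> R}"
      using that assms(4) irr by (auto dest: transD)
    then show ?thesis unfolding g_def using assms(1) by (simp add: psubset_card_mono)
  qed
  have tot: "(a, b) \<in> R \<or> (b, a) \<in> R" if "a \<in> T" "b \<in> T" "a \<noteq> b" for a b
    using that assms(2) by blast
  have iff: "(a, b) \<in> R \<longleftrightarrow> g a < g b" if "a \<in> T" "b \<in> T" for a b
    using less[of a b] less[of b a] tot[OF that] by fastforce
  have inj: "inj_on g T"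
    using less tot by (fastforce intro: inj_onI)
  have "g a \<in> {1..card T}" if "a \<in> T" for a
  proof -
    have "{x \<in> T. (x, a) \<in> R} \<subset> T" using that irr by blast
    then show ?thesis unfolding g_def using assms(1) by (simp add: Suc_le_eq psubset_card_mono)
  qed
  then have "g ` T = {1..card T}"
    using inj by (intro card_subset_eq) (auto simp: card_image)
  then show ?thesis using inj iff by (auto simp: bij_betw_def)
qed

section \<open>Relations whose only compatible permutation is the identity\<close>

text \<open>An element of \<open>T\<close> stands for a matching edge, and \<open>E a b\<close> says
  that the left end of \<open>a\<close> is adjacent to the right end of \<open>b\<close>. A
  permutation \<open>p\<close> with \<open>E a (p a)\<close> throughout is a perfect matching on
  these ends, the identity being the given one. Rigidity is thus uniqueness of that
  matching.\<close>

locale rigid_relation =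
  fixes T :: "'a set" and E :: "'a \<Rightarrow> 'a \<Rightarrow> bool"
  assumes finite: "finite T"
    and refl: "a \<in> T \<Longrightarrow> E a a"
    and rigid: "p permutes T \<Longrightarrow> (\<And>a. a \<in> T \<Longrightarrow> E a (p a)) \<Longrightarrow> p = id"
begin

definition R :: "('a \<times> 'a) set" where
  "R = {(a, b) \<in> T \<times> T. \<not> E a b}"

lemma finite_R: "finite R"
  using finite unfolding R_def by (auto intro: finite_subset[of _ "T \<times> T"])

text \<open>If neither (a, b) nor (b, a) were a non-edge, \<open>transpose a b\<close> would
  exchange partners along an alternating 4-cycle, against rigidity.\<close>

lemma R_Un_converse: "R \<union> R\<inverse> = T \<times> T - Id"
proof -
  have "(a, b) \<in> R \<or> (b, a) \<in> R" if "a \<in> T" "b \<in> T" "a \<noteq> b" for a b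
  proof (rule ccontr)
    assume "\<not> ?thesis"
    then have "E a b" "E b a" using that by (auto simp: R_def)
    then have "E c (transpose a b c)" if "c \<in> T" for c
      using that refl by (simp add: transpose_def)
    then have "transpose a b = id"
      using that by (intro rigid permutes_swap_id) auto
    then show False using \<open>a \<noteq> b\<close> by (metis id_apply transpose_apply_first)
  qed
  then show ?thesis using refl by (auto simp: R_def)
qed

lemma card_R_ge: "card T * (card T - 1) \<le> 2 * card R"
  using card_Un_converse[OF finite_R] card_off_diagonal[OF finite]
  by (simp add: R_Un_converse)

text \<open>Equality leaves nothing for the intersection to count, so no pair is missing in both
  directions. Every non-edge then comes with an edge in the other direction, and a failure of
  transitivity closes an alternating 6-cycle.\<close>

lemma
  assumes "2 * card R = card T * (card T - 1)"
  shows R_antisym: "R \<inter> R\<inverse> = {}" and R_trans: "trans R"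
proof -
  have "card (R \<inter> R\<inverse>) = 0"
    using card_Un_converse[OF finite_R] card_off_diagonal[OF finite] assms
    by (simp add: R_Un_converse)
  then show anti: "R \<inter> R\<inverse> = {}" using finite_R by simp
  show "trans R"
  proof (rule transI, rule ccontr)
    fix a b c assume ab: "(a, b) \<in> R" and bc: "(b, c) \<in> R" and ac: "(a, c) \<notin> R"
    have T: "a \<in> T" "b \<in> T" "c \<in> T" using ab bc by (auto simp: R_def)
    have ba: "(b, a) \<notin> R" and cb: "(c, b) \<notin> R" using ab bc anti by blast+
    have ne: "a \<noteq> b" "b \<noteq> c" "a \<noteq> c" using ab bc ba cb by blast+
    have E: "E b a" "E c b" "E a c" using ba cb ac T by (simp_all add: R_def)
    \<comment> \<open>The cycle a to c to b to a; its three arrows are the facts collected in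
      \<open>E\<close>.\<close>
    define p where "p = transpose a b \<circ> transpose a c"
    have p: "p a = c" "p b = a" "p c = b" "\<And>x. x \<notin> {a, b, c} \<Longrightarrow> p x = x"
      using ne by (auto simp: p_def transpose_def)
    have "p permutes T"
      unfolding p_def using T by (intro permutes_compose permutes_swap_id)
    moreover have "E x (p x)" if "x \<in> T" for x
    proof (cases "x \<in> {a, b, c}")
      case True
      then show ?thesis using E p(1-3) by (metis emptyE insertE)
    next
      case False
      then show ?thesis using p(4) refl that by simp
    qed
    ultimately have "p = id" by (rule rigid)
    then show False using p(1) ne by simp
  qed
qed

text \<open>\<open>N\<close> also counts pairs with a component outside \<open>T\<close>, while
  those inside \<open>T\<close> already reach the bound. At equality \<open>N\<close> is therefore
  \<open>R\<close>, and the ranking of \<open>T\<close> extends to \<open>A\<close>.\<close>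

lemma card_nonedges:
  assumes "finite A" "T \<subseteq> A"
  defines "N \<equiv> {(a, b) \<in> A \<times> A. \<not> E a b}"
  shows card_nonedges_ge: "card T * (card T - 1) \<le> 2 * card N"
    and numbering: "2 * card N = card T * (card T - 1) \<Longrightarrow>
      \<exists>g. bij_betw g A {1..card A} \<and>
        (\<forall>a\<in>A. \<forall>b\<in>A. \<not> E a b \<longleftrightarrow> g a < g b \<and> g b \<le> card T)"
proof -
  have finN: "finite N"
    unfolding N_def using assms(1) by (auto intro: finite_subset[of _ "A \<times> A"])
  have RN: "R \<subseteq> N" using assms(2) by (auto simp: R_def N_def)
  have le: "card R \<le> card N" using RN finN by (rule card_mono[rotated])
  show "card T * (card T - 1) \<le> 2 * card N" using le card_R_ge by simp
  assume eq: "2 * card N = card T * (card T - 1)"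
  then have cR: "2 * card R = card T * (card T - 1)" using le card_R_ge by simp
  have "R = N" using eq cR RN finN by (intro card_subset_eq) auto
  then have iffR: "\<not> E a b \<longleftrightarrow> (a, b) \<in> R" if "a \<in> A" "b \<in> A" for a b
    using that by (auto simp: N_def)
  obtain g where g: "bij_betw g T {1..card T}"
      "\<And>a b. a \<in> T \<Longrightarrow> b \<in> T \<Longrightarrow> (a, b) \<in> R \<longleftrightarrow> g a < g b"
    using transitive_tournament_rank[OF finite R_Un_converse R_antisym[OF cR] R_trans[OF cR]]
    by blast
  have TA: "card T \<le> card A" using assms(1,2) by (rule card_mono)
  \<comment> \<open>Elements outside \<open>T\<close> receive the numbers above
    \<open>card T\<close> in any order.\<close>
  have "card (A - T) = card {Suc (card T)..card A}"
    using assms(1,2) finite by (simp add: card_Diff_subset)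
  then obtain h where h: "bij_betw h (A - T) {Suc (card T)..card A}"
    using finite_same_card_bij assms(1) by (metis finite_Diff finite_atLeastAtMost)
  define r where "r a = (if a \<in> T then g a else h a)" for a
  have "bij_betw r (T \<union> (A - T)) ({1..card T} \<union> {Suc (card T)..card A})"
  proof (rule bij_betw_combine)
    show "bij_betw r T {1..card T}"
      using g(1) by (subst bij_betw_cong[of T r g]) (auto simp: r_def)
    show "bij_betw r (A - T) {Suc (card T)..card A}"
      using h by (subst bij_betw_cong[of "A - T" r h]) (auto simp: r_def)
  qed auto
  moreover have "T \<union> (A - T) = A" using assms(2) by blast
  moreover have "{1..card T} \<union> {Suc (card T)..card A} = {1..card A}" using TA by auto
  ultimately have r: "bij_betw r A {1..card A}" by simp
  have rT: "r a \<le> card T \<longleftrightarrow> a \<in> T" if "a \<in> A" for a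
    using that bij_betw_apply[OF g(1), of a] bij_betw_apply[OF h, of a]
    by (cases "a \<in> T") (auto simp: r_def)
  have "\<not> E a b \<longleftrightarrow> r a < r b \<and> r b \<le> card T" if "a \<in> A" "b \<in> A" for a b
  proof (cases "a \<in> T \<and> b \<in> T")
    case True
    then show ?thesis using iffR[OF that] g(2)[of a b] rT[of b] that by (auto simp: r_def)
  next
    case False
    then have "(a, b) \<notin> R" by (auto simp: R_def)
    \<comment> \<open>If \<open>b\<close> is outside \<open>T\<close>, the second inequality fails.
      If only \<open>a\<close> is, then \<open>r a\<close> exceeds \<open>card T\<close>, so the two
      cannot hold together.\<close>
    moreover have "\<not> (r a < r b \<and> r b \<le> card T)" using False rT[of a] rT[of b] that by auto
    ultimately show ?thesis using iffR[OF that] by simp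
  qed
  with r show "\<exists>g. bij_betw g A {1..card A} \<and>
        (\<forall>a\<in>A. \<forall>b\<in>A. \<not> E a b \<longleftrightarrow> g a < g b \<and> g b \<le> card T)"
    by blast
qed

end

section \<open>Bipartite graphs as relations\<close>

text \<open>The map \<open>f\<close> identifies the side \<open>B\<close> with \<open>A\<close>; later it is the perfect matching.\<close>

lemma card_bipartite_edges:
  assumes "finite A" "bij_betw f A B" "A \<inter> B = {}"
    and "\<And>e. e \<in> F \<Longrightarrow> \<exists>a\<in>A. \<exists>b\<in>B. e = {a, b}"
  shows "card F + card {(a, b) \<in> A \<times> A. {a, f b} \<notin> F} = (card A)\<^sup>2"
proof -
  let ?P = "{(a, b) \<in> A \<times> A. {a, f b} \<in> F}"
  let ?N = "{(a, b) \<in> A \<times> A. {a, f b} \<notin> F}"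
  have fB: "f a \<in> B" if "a \<in> A" for a using assms(2) that by (rule bij_betw_apply)
  have "bij_betw (\<lambda>(a, b). {a, f b}) ?P F"
  proof (rule bij_betw_imageI)
    show "inj_on (\<lambda>(a, b). {a, f b}) ?P"
    proof (rule inj_onI, clarify)
      fix a b c d assume *: "a \<in> A" "b \<in> A" "c \<in> A" "d \<in> A" "{a, f b} = {c, f d}"
      \<comment> \<open>Disjointness of the sides rules out the crossed reading of the equality of
        doubletons.\<close>
      then have "a \<noteq> f d" using fB[of d] assms(3) by blast
      then have "a = c" "f b = f d" using *(5) by (simp_all add: doubleton_eq_iff)
      then show "a = c \<and> b = d" using * assms(2) by (metis bij_betw_imp_inj_on inj_onD)
    qed
    show "(\<lambda>(a, b). {a, f b}) ` ?P = F"
    proof (intro equalityI subsetI)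
      fix e assume "e \<in> F"
      then obtain a b where "a \<in> A" "b \<in> B" "e = {a, b}" using assms(4) by blast
      moreover obtain c where "c \<in> A" "b = f c"
        using \<open>b \<in> B\<close> assms(2) by (metis bij_betw_imp_surj_on imageE)
      ultimately have "(a, c) \<in> ?P" "e = {a, f c}" using \<open>e \<in> F\<close> by auto
      then show "e \<in> (\<lambda>(a, b). {a, f b}) ` ?P" by (intro image_eqI[of _ _ "(a, c)"]) auto
    qed auto
  qed
  then have "card F = card ?P" by (rule bij_betw_same_card[symmetric])
  moreover have "?P \<union> ?N = A \<times> A" by auto
  moreover have "finite (A \<times> A)" using assms(1) by simp
  then have "card ?P + card ?N = card (?P \<union> ?N)"
    by (intro card_Un_disjoint[symmetric]) (auto elim: rev_finite_subset)
  ultimately show ?thesis by (simp add: card_cartesian_product power2_eq_square)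
qed

section \<open>The extremal graph and isomorphism with it\<close>

lemma H_graph_edge_iff:
  "{Inl i, Inr j} \<in> edges (H_graph n k) \<longleftrightarrow>
    i \<in> {1..n} \<and> j \<in> {1..n} \<and> \<not> (i < j \<and> j \<le> n - k)"
  by (auto simp: H_graph_def doubleton_eq_iff)

lemma H_graph_edgeE:
  assumes "e \<in> edges (H_graph n k)"
  obtains i j where "i \<in> {1..n}" "j \<in> {1..n}" "e = {Inl i, Inr j}"
  using assms by (auto simp: H_graph_def)

lemma H_graph_no_edge:
  "{Inl i, Inl j} \<notin> edges (H_graph n k)" "{Inr i, Inr j} \<notin> edges (H_graph n k)"
  by (auto simp: H_graph_def doubleton_eq_iff)

text \<open>The non-edges are the pairs i < j in \<open>{1..n - k}\<close>, a tournament. The count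
  is doubled to avoid division.\<close>

lemma card_H_graph_edges:
  "2 * card (edges (H_graph n k)) + (n - k) * (n - k - 1) = 2 * n\<^sup>2"
proof -
  let ?F = "edges (H_graph n k)"
  let ?A = "Inl ` {1..n} :: (nat + nat) set" and ?B = "Inr ` {1..n} :: (nat + nat) set"
  let ?f = "\<lambda>x. case x of Inl i \<Rightarrow> Inr i | Inr i \<Rightarrow> Inl i"
  let ?N = "{(a, b) \<in> ?A \<times> ?A. {a, ?f b} \<notin> ?F}"
  let ?R = "{(i, j). i \<in> {1..n - k} \<and> j \<in> {1..n - k} \<and> i < j}"
  have "bij_betw ?f ?A ?B"
    by (rule bij_betw_imageI) (auto simp: inj_on_def image_image)
  then have "card ?F + card ?N = (card ?A)\<^sup>2"
  proof (rule card_bipartite_edges[rotated])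
    show "\<exists>a\<in>?A. \<exists>b\<in>?B. e = {a, b}" if "e \<in> ?F" for e
      using that by (rule H_graph_edgeE) blast
  qed auto
  moreover have "card ?N = card ?R"
  proof -
    have "?N = map_prod Inl Inl ` ?R"
      by (auto simp: H_graph_edge_iff image_iff)
    then show ?thesis by (simp add: card_image inj_on_def)
  qed
  moreover have "2 * card ?R = card {1..n - k} * (card {1..n - k} - 1)"
    by (rule card_tournament) auto
  moreover have "card ?A = n" by (simp add: card_image)
  ultimately show ?thesis by simp
qed

text \<open>An isomorphism is only constrained on pairs of vertices, so all edges of both graphs are
  required to be such pairs. Taking images under it is then a bijection between the edge
  sets.\<close>

lemma card_edges_isomorphic:
  assumes iso: "graph_isomorphic G H"
    and G: "\<And>e. e \<in> edges G \<Longrightarrow> \<exists>u\<in>vertices G. \<exists>v\<in>vertices G. e = {u, v}"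
    and H: "\<And>e. e \<in> edges H \<Longrightarrow> \<exists>u\<in>vertices H. \<exists>v\<in>vertices H. e = {u, v}"
  shows "card (edges G) = card (edges H)"
proof -
  obtain \<phi> where bij: "bij_betw \<phi> (vertices G) (vertices H)"
    and \<phi>: "\<And>u v. u \<in> vertices G \<Longrightarrow> v \<in> vertices G \<Longrightarrow>
      {u, v} \<in> edges G \<longleftrightarrow> {\<phi> u, \<phi> v} \<in> edges H"
    using iso unfolding graph_isomorphic_def by blast
  have "edges G \<subseteq> Pow (vertices G)" using G by blast
  then have "inj_on ((`) \<phi>) (edges G)"
    using inj_on_image_Pow[of \<phi> "vertices G"] bij by (auto simp: bij_betw_def intro: inj_on_subset)
  moreover have "(`) \<phi> ` edges G = edges H"
  proof (intro equalityI subsetI)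
    fix e assume "e \<in> (`) \<phi> ` edges G"
    then obtain d where "d \<in> edges G" "e = \<phi> ` d" by blast
    moreover then obtain u v where "u \<in> vertices G" "v \<in> vertices G" "d = {u, v}"
      using G by blast
    ultimately show "e \<in> edges H" using \<phi>[of u v] by simp
  next
    fix e assume e: "e \<in> edges H"
    then obtain x y where "x \<in> vertices H" "y \<in> vertices H" "e = {x, y}" using H by blast
    moreover then obtain u v where "u \<in> vertices G" "v \<in> vertices G" "x = \<phi> u" "y = \<phi> v"
      using bij unfolding bij_betw_def by blast
    ultimately have "{u, v} \<in> edges G" "e = \<phi> ` {u, v}" using \<phi>[of u v] e by auto
    then show "e \<in> (`) \<phi> ` edges G" by blast
  qed
  ultimately show ?thesis by (metis card_image)
qed

text \<open>The numbering \<open>g\<close> of \<open>A\<close> is carried over to \<open>B\<close>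
  along the matching \<open>f\<close>, so that matched vertices share an index. Pairs across the
  sides are settled by \<open>non\<close>, and pairs within one side are non-edges in both
  graphs.\<close>

lemma isomorphic_H_graphI:
  assumes V: "A \<union> B = vertices G" "A \<inter> B = {}"
    and E: "\<And>e. e \<in> edges G \<Longrightarrow> \<exists>a\<in>A. \<exists>b\<in>B. e = {a, b}"
    and f: "bij_betw f A B" and g: "bij_betw g A {1..n}"
    and non: "\<And>a b. a \<in> A \<Longrightarrow> b \<in> A \<Longrightarrow> {a, f b} \<notin> edges G \<longleftrightarrow> g a < g b \<and> g b \<le> n - k"
  shows "graph_isomorphic G (H_graph n k)"
proof -
  define h where "h = g \<circ> the_inv_into A f"
  define \<phi> where "\<phi> v = (if v \<in> A then Inl (g v) else Inr (h v))" for v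
  have h: "bij_betw h B {1..n}"
    unfolding h_def using f g by (blast intro: bij_betw_trans bij_betw_the_inv_into)
  have hf: "h (f a) = g a" if "a \<in> A" for a
    using that f by (simp add: h_def the_inv_into_f_f bij_betw_def)
  have "bij_betw \<phi> (A \<union> B) (Inl ` {1..n} \<union> Inr ` {1..n})"
  proof (rule bij_betw_combine)
    have "bij_betw (Inl \<circ> g) A (Inl ` {1..n})"
      using g by (rule bij_betw_trans) (simp add: bij_betw_def)
    then show "bij_betw \<phi> A (Inl ` {1..n})"
      by (subst bij_betw_cong[of A \<phi> "Inl \<circ> g"]) (auto simp: \<phi>_def)
    have "bij_betw (Inr \<circ> h) B (Inr ` {1..n})"
      using h by (rule bij_betw_trans) (simp add: bij_betw_def)
    then show "bij_betw \<phi> B (Inr ` {1..n})"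
      using V(2) by (subst bij_betw_cong[of B \<phi> "Inr \<circ> h"]) (auto simp: \<phi>_def)
  qed auto
  then have bij: "bij_betw \<phi> (vertices G) (vertices (H_graph n k))"
    using V(1) by (simp add: H_graph_def)
  have AB: "{a, b} \<in> edges G \<longleftrightarrow> {\<phi> a, \<phi> b} \<in> edges (H_graph n k)"
    if ab: "a \<in> A" "b \<in> B" for a b
  proof -
    obtain c where c: "c \<in> A" "b = f c" using ab(2) f by (auto simp: bij_betw_def)
    have "\<phi> a = Inl (g a)" "\<phi> b = Inr (g c)"
      using ab c V(2) hf by (auto simp: \<phi>_def)
    moreover have "g a \<in> {1..n}" "g c \<in> {1..n}" using ab c g by (auto dest: bij_betw_apply)
    ultimately show ?thesis using non[OF ab(1) c(1)] c(2) by (auto simp: H_graph_edge_iff)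
  qed
  have "{u, v} \<in> edges G \<longleftrightarrow> {\<phi> u, \<phi> v} \<in> edges (H_graph n k)"
    if uv: "u \<in> vertices G" "v \<in> vertices G" for u v
  proof -
    consider "u \<in> A" "v \<in> B" | "u \<in> B" "v \<in> A" | "u \<in> A" "v \<in> A" | "u \<in> B" "v \<in> B"
      using uv V(1) by blast
    then show ?thesis
    proof cases
      case 1
      then show ?thesis by (rule AB)
    next
      case 2
      then show ?thesis using AB[of v u] by (metis insert_commute)
    next
      case 3
      then have "{u, v} \<notin> edges G"
        using V(2) by (auto dest!: E simp: doubleton_eq_iff)
      then show ?thesis using 3 by (simp add: \<phi>_def H_graph_no_edge)
    next
      case 4
      then have "{u, v} \<notin> edges G" "u \<notin> A" "v \<notin> A"
        using V(2) by (auto dest!: E simp: doubleton_eq_iff)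
      then show ?thesis by (simp add: \<phi>_def H_graph_no_edge)
    qed
  qed
  with bij show ?thesis unfolding graph_isomorphic_def by blast
qed

section \<open>Perfect matchings and forcing sets\<close>

text \<open>At any vertex of an edge of \<open>M'\<close>, the edge of \<open>M\<close> there also
  lies in \<open>M'\<close>, so the two coincide. Hence a perfect matching forces itself, and
  forcing sets exist.\<close>

lemma perfect_matching_subset_eq:
  assumes G: "finite_simple_graph G" and M: "perfect_matching G M"
    and M': "perfect_matching G M'" and sub: "M \<subseteq> M'"
  shows "M' = M"
proof
  show "M' \<subseteq> M"
  proof
    fix e assume e: "e \<in> M'"
    then have "e \<subseteq> vertices G" "card e = 2"
      using M' G by (auto simp: perfect_matching_def finite_simple_graph_def)
    then obtain v where v: "v \<in> e" "v \<in> vertices G" by (auto simp: card_2_iff)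
    then obtain d where d: "d \<in> M" "v \<in> d" using M unfolding perfect_matching_def by blast
    have "\<exists>!e. e \<in> M' \<and> v \<in> e" using v M' unfolding perfect_matching_def by blast
    then have "d = e" using e v d sub by blast
    then show "e \<in> M" using d by simp
  qed
qed (rule sub)

text \<open>\<open>Min\<close> is attained only on finite nonempty sets, so both properties are
  checked for each of the two nested minima.\<close>

lemma forcing_number_witness:
  assumes G: "finite_simple_graph G" and ex: "\<exists>M. perfect_matching G M"
  obtains M S where "perfect_matching G M" "forcing_set G M S" "card S = forcing_number G"
proof -
  have finE: "finite (edges G)"
    using G by (auto simp: finite_simple_graph_def intro!: finite_subset[of _ "Pow (vertices G)"])
  have "{M. perfect_matching G M} \<subseteq> Pow (edges G)" by (auto simp: perfect_matching_def)
  then have "finite {M. perfect_matching G M}" using finE by (simp add: finite_subset)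
  then have "finite {forcing_number_of G M | M. perfect_matching G M}" by simp
  moreover have "{forcing_number_of G M | M. perfect_matching G M} \<noteq> {}" using ex by blast
  ultimately have "forcing_number G \<in> {forcing_number_of G M | M. perfect_matching G M}"
    unfolding forcing_number_def by (rule Min_in)
  then obtain M where M: "perfect_matching G M" "forcing_number G = forcing_number_of G M"
    by blast
  have "M \<subseteq> edges G" using M(1) by (simp add: perfect_matching_def)
  then have "{S. forcing_set G M S} \<subseteq> Pow (edges G)"
    unfolding forcing_set_def by blast
  then have "finite {S. forcing_set G M S}" using finE by (simp add: finite_subset)
  then have "finite {card S | S. forcing_set G M S}" by simp
  moreover have "forcing_set G M M"
    using perfect_matching_subset_eq[OF G M(1)] by (auto simp: forcing_set_def)
  then have "{card S | S. forcing_set G M S} \<noteq> {}" by blast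
  ultimately have "forcing_number_of G M \<in> {card S | S. forcing_set G M S}"
    unfolding forcing_number_of_def by (rule Min_in)
  then show thesis using that M by auto
qed

text \<open>Covering of \<open>A\<close> gives the function, uniqueness at vertices of
  \<open>B\<close> its injectivity, and covering of \<open>B\<close> its surjectivity.\<close>

lemma perfect_matching_bij:
  assumes V: "A \<union> B = vertices G" "A \<inter> B = {}"
    and E: "\<And>e. e \<in> edges G \<Longrightarrow> \<exists>a\<in>A. \<exists>b\<in>B. e = {a, b}"
    and M: "perfect_matching G M"
  obtains f where "bij_betw f A B" "M = (\<lambda>a. {a, f a}) ` A"
proof -
  have sub: "M \<subseteq> edges G" and ex1: "\<And>v. v \<in> A \<union> B \<Longrightarrow> \<exists>!e. e \<in> M \<and> v \<in> e"
    using M V(1) by (auto simp: perfect_matching_def)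
  have "\<exists>b. b \<in> B \<and> {a, b} \<in> M" if a: "a \<in> A" for a
  proof -
    obtain e where e: "e \<in> M" "a \<in> e" using ex1[of a] a by blast
    then obtain a' b where "a' \<in> A" "b \<in> B" "e = {a', b}" using sub E by blast
    then show ?thesis using e a V(2) by blast
  qed
  then obtain f where f: "\<And>a. a \<in> A \<Longrightarrow> f a \<in> B \<and> {a, f a} \<in> M" by metis
  have uniq: "e = d" if "e \<in> M" "d \<in> M" "v \<in> e" "v \<in> d" "v \<in> A \<union> B" for e d v
    using ex1 that by blast
  have M_eq: "M = (\<lambda>a. {a, f a}) ` A"
  proof (intro equalityI subsetI)
    fix e assume e: "e \<in> M"
    then obtain a b where "a \<in> A" "b \<in> B" "e = {a, b}" using sub E by blast
    then have "e = {a, f a}" using uniq[of e "{a, f a}" a] e f by auto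
    then show "e \<in> (\<lambda>a. {a, f a}) ` A" using \<open>a \<in> A\<close> by blast
  qed (use f in auto)
  have "bij_betw f A B"
  proof (rule bij_betw_imageI)
    show "inj_on f A"
    proof (rule inj_onI)
      fix a c assume ac: "a \<in> A" "c \<in> A" "f a = f c"
      then have "{a, f a} = {c, f c}" 
        using uniq[OF conjunct2[OF f] conjunct2[OF f], of a c "f a"] f by simp
      then show "a = c" using ac(3) by (metis doubleton_eq_iff)
    qed
    show "f ` A = B"
    proof (intro equalityI subsetI)
      fix b assume b: "b \<in> B"
      then obtain e where "e \<in> M" "b \<in> e" using ex1[of b] by blast
      then show "b \<in> f ` A" using M_eq b V(2) by auto
    qed (use f in auto)
  qed
  then show thesis using M_eq by (rule that)
qed

lemma perfect_matchingI:
  assumes V: "A \<union> B = vertices G" "A \<inter> B = {}"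
    and h: "bij_betw h A B" and E: "\<And>a. a \<in> A \<Longrightarrow> {a, h a} \<in> edges G"
  shows "perfect_matching G ((\<lambda>a. {a, h a}) ` A)"
proof -
  have hB: "h a \<in> B" if "a \<in> A" for a using h that by (rule bij_betw_apply)
  have "\<exists>!e. e \<in> (\<lambda>a. {a, h a}) ` A \<and> v \<in> e" if "v \<in> A \<union> B" for v
  proof -
    obtain a where a: "a \<in> A" "v = a \<or> v = h a"
      using \<open>v \<in> A \<union> B\<close> h by (auto simp: bij_betw_def)
    show ?thesis
    proof (rule ex1I[of _ "{a, h a}"])
      show "{a, h a} \<in> (\<lambda>a. {a, h a}) ` A \<and> v \<in> {a, h a}" using a by blast
      fix e assume "e \<in> (\<lambda>a. {a, h a}) ` A \<and> v \<in> e"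
      then obtain c where c: "c \<in> A" "e = {c, h c}" "v = c \<or> v = h c" by blast
      \<comment> \<open>Disjoint sides exclude that \<open>v\<close> is a left end of one edge and a
        right end of the other; \<open>h\<close> is injective.\<close>
      have "c = a"
        using a c hB V(2) h by (auto simp: bij_betw_def inj_on_def)
      then show "e = {a, h a}" using c by simp
    qed
  qed
  then show ?thesis using V(1) E by (auto simp: perfect_matching_def)
qed

text \<open>A compatible permutation \<open>p\<close> of the pairs outside \<open>S\<close> fixes
  the pairs in \<open>S\<close>, so \<open>f \<circ> p\<close> describes a perfect matching that
  contains \<open>S\<close>. Forcing makes it \<open>M\<close>, and \<open>p\<close> is the
  identity.\<close>

lemma rigid_relation_forcing_set:
  assumes V: "A \<union> B = vertices G" "A \<inter> B = {}" and fin: "finite A"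
    and M: "perfect_matching G M" and f: "bij_betw f A B" and M_eq: "M = (\<lambda>a. {a, f a}) ` A"
    and S: "forcing_set G M S"
  shows "rigid_relation {a \<in> A. {a, f a} \<notin> S} (\<lambda>a b. {a, f b} \<in> edges G)"
proof
  let ?T = "{a \<in> A. {a, f a} \<notin> S}"
  show "finite ?T" using fin by simp
  have refl: "{a, f a} \<in> edges G" if "a \<in> A" for a
    using that M M_eq by (auto simp: perfect_matching_def)
  then show "{a, f a} \<in> edges G" if "a \<in> ?T" for a using that by simp
  fix p assume p: "p permutes ?T" and E: "\<And>a. a \<in> ?T \<Longrightarrow> {a, f (p a)} \<in> edges G"
  have fix_p: "p a = a" if "a \<notin> ?T" for a using p that by (rule permutes_not_in)
  have pA: "p permutes A" using p by (rule permutes_subset) auto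
  have h: "bij_betw (f \<circ> p) A B"
    using permutes_imp_bij[OF pA] f by (rule bij_betw_trans)
  let ?M' = "(\<lambda>a. {a, (f \<circ> p) a}) ` A"
  have "perfect_matching G ?M'"
  proof (rule perfect_matchingI[OF V h])
    show "{a, (f \<circ> p) a} \<in> edges G" if "a \<in> A" for a
      using that refl E fix_p by (cases "a \<in> ?T") (simp_all del: mem_Collect_eq)
  qed
  moreover have "S \<subseteq> ?M'"
  proof
    fix e assume e: "e \<in> S"
    then obtain a where "a \<in> A" "e = {a, f a}"
      using S M_eq by (auto simp: forcing_set_def)
    moreover then have "p a = a" using e by (intro fix_p) auto
    ultimately show "e \<in> ?M'" by (intro image_eqI[of _ _ a]) auto
  qed
  ultimately have eq: "?M' = M" using S unfolding forcing_set_def by blast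
  show "p = id"
  proof
    fix a
    show "p a = id a"
    proof (cases "a \<in> A")
      case True
      then have "{a, f (p a)} \<in> M" using eq by auto
      then obtain c where c: "c \<in> A" "{a, f (p a)} = {c, f c}" using M_eq by auto
      have "p a \<in> A" using pA True by (simp add: permutes_in_image)
      then have fB: "f (p a) \<in> B" "f c \<in> B" using c f by (auto dest: bij_betw_apply)
      then have "f (p a) = f a" using c True V(2) by (auto simp: doubleton_eq_iff)
      then show ?thesis using \<open>p a \<in> A\<close> True f by (auto simp: bij_betw_def inj_on_def)
    qed (simp add: fix_p)
  qed
qed

section \<open>The bound and the case of equality\<close>

theorem theorem2p3:
  fixes G :: "'a ugraph" and n k :: nat
  assumes "finite_simple_graph G"
    and "bipartite G"
    and "card (vertices G) = 2 * n"
    and "\<exists>M. perfect_matching G M"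
    and "forcing_number G = k"
    and "k < n"
  shows "real (card (edges G)) \<le> (real n - real k) * (real n + real k + 1) / 2 + real n * real k
    \<and> (real (card (edges G)) = (real n - real k) * (real n + real k + 1) / 2 + real n * real k
         \<longleftrightarrow> graph_isomorphic G (H_graph n k))"
proof -
  obtain A B where V: "A \<union> B = vertices G" "A \<inter> B = {}"
    and E': "\<forall>e\<in>edges G. \<exists>a\<in>A. \<exists>b\<in>B. e = {a, b}"
    using assms(2) unfolding bipartite_def by (elim exE conjE)
  have E: "\<exists>a\<in>A. \<exists>b\<in>B. e = {a, b}" if "e \<in> edges G" for e
    using E' that by (rule bspec)
  have fin: "finite A" "finite B"
    using assms(1) V(1) unfolding finite_simple_graph_def by (metis finite_Un)+
  obtain M S where M: "perfect_matching G M" and S: "forcing_set G M S" and cS: "card S = k"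
    using forcing_number_witness[OF assms(1,4)] assms(5) by metis
  obtain f where f: "bij_betw f A B" and M_eq: "M = (\<lambda>a. {a, f a}) ` A"
    using perfect_matching_bij[OF V E M] by blast
  have "card A = card B" using f by (rule bij_betw_same_card)
  moreover have "card A + card B = 2 * n"
    using V fin assms(3) by (metis card_Un_disjoint)
  ultimately have cA: "card A = n" by simp
  \<comment> \<open>The left ends of the matching edges outside the forcing set.\<close>
  define T where "T = {a \<in> A. {a, f a} \<notin> S}"
  have inj: "inj_on (\<lambda>a. {a, f a}) A"
    using V(2) f by (intro inj_onI) (auto simp: doubleton_eq_iff dest: bij_betw_apply)
  have "S = (\<lambda>a. {a, f a}) ` (A - T)"
    using S M_eq by (auto simp: forcing_set_def T_def)
  then have "card (A - T) = k" using cS inj by (metis card_image Diff_subset inj_on_subset)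
  moreover have "T \<subseteq> A" by (auto simp: T_def)
  ultimately have cT: "card T = n - k"
    using card_Diff_subset[of T A] card_mono[of A T] fin cA finite_subset[of T A] by simp
  interpret rigid_relation T "\<lambda>a b. {a, f b} \<in> edges G"
    unfolding T_def using rigid_relation_forcing_set[OF V fin(1) M f M_eq S] .
  define N where "N = {(a, b) \<in> A \<times> A. {a, f b} \<notin> edges G}"
  have total: "card (edges G) + card N = n\<^sup>2"
    using card_bipartite_edges[OF fin(1) f V(2) E] cA by (simp add: N_def)
  have ge: "(n - k) * (n - k - 1) \<le> 2 * card N"
    using card_nonedges_ge[OF fin(1) \<open>T \<subseteq> A\<close>] cT by (simp add: N_def)
  \<comment> \<open>Here \<open>k < n\<close> matters: neither n - k nor n - k - 1
    truncates.\<close>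
  have "real ((n - k) * (n - k - 1)) = (real n - real k) * (real n - real k - 1)"
    using assms(6) by (simp add: of_nat_diff)
  \<comment> \<open>With m = n - k, the claimed bound is all \<open>n\<^sup>2\<close> pairs minus
    m(m - 1)/2.\<close>
  then have bound: "(real n - real k) * (real n + real k + 1) / 2 + real n * real k =
      real (n\<^sup>2) - real ((n - k) * (n - k - 1)) / 2"
    by (simp add: field_simps power2_eq_square)
  \<comment> \<open>This form reduces the inequality and the equality to a comparison of the
    naturals \<open>2 * card N\<close> and \<open>(n - k) * (n - k - 1)\<close>.\<close>
  have realE: "real (card (edges G)) = real (n\<^sup>2) - real (2 * card N) / 2"
    using total by (simp flip: total)
  have half: "x - real a / 2 = x - real b / 2 \<longleftrightarrow> a = b" for x :: real and a b :: nat
    by simp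
  have iff: "real (card (edges G)) =
      (real n - real k) * (real n + real k + 1) / 2 + real n * real k \<longleftrightarrow>
      2 * card N = (n - k) * (n - k - 1)"
    unfolding bound realE by (rule half)
  have "2 * card N = (n - k) * (n - k - 1) \<longleftrightarrow> graph_isomorphic G (H_graph n k)"
  proof
    assume "2 * card N = (n - k) * (n - k - 1)"
    from numbering[OF fin(1) \<open>T \<subseteq> A\<close>, folded N_def, unfolded cT cA, OF this]
    obtain g where "bij_betw g A {1..n}"
      "\<forall>a\<in>A. \<forall>b\<in>A. {a, f b} \<notin> edges G \<longleftrightarrow> g a < g b \<and> g b \<le> n - k"
      by (elim exE conjE)
    then show "graph_isomorphic G (H_graph n k)"
      using isomorphic_H_graphI[OF V E f] by simp
  next
    assume "graph_isomorphic G (H_graph n k)"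
    then have "card (edges G) = card (edges (H_graph n k))"
    proof (rule card_edges_isomorphic)
      show "\<exists>u\<in>vertices G. \<exists>v\<in>vertices G. e = {u, v}" if "e \<in> edges G" for e
        using E[OF that] V(1) by blast
      show "\<exists>u\<in>vertices (H_graph n k). \<exists>v\<in>vertices (H_graph n k). e = {u, v}"
        if "e \<in> edges (H_graph n k)" for e
      proof -
        obtain i j where "i \<in> {1..n}" "j \<in> {1..n}" "e = {Inl i, Inr j}"
          using \<open>e \<in> edges (H_graph n k)\<close> by (rule H_graph_edgeE)
        then show ?thesis
          by (intro bexI[of _ "Inl i"] bexI[of _ "Inr j"]) (simp_all add: H_graph_def)
      qed
    qed
    \<comment> \<open>Equal edge counts among the same number \<open>n\<^sup>2\<close> of pairs
      leave equally many non-edges.\<close>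
    then show "2 * card N = (n - k) * (n - k - 1)"
      using card_H_graph_edges[of n k] total by simp
  qed
  moreover have "real (card (edges G)) \<le>
      (real n - real k) * (real n + real k + 1) / 2 + real n * real k"
    unfolding bound realE using ge by (intro diff_left_mono divide_right_mono of_nat_mono) simp_all
  ultimately show ?thesis using iff by blast
qed

end
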